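(* Let $X_t=\gamma t+\sigma W_t+\sum_{j=1}^{N_t}Y_j$ and assume that the standard Poisson process $N_t$ jumps $m$ times in the time interval $[0,t]$, that is, $N_t=m$ with $m\in\mathbb N_0$. Suppose that $Y_j$ is normally distributed with mean $\mu$ and variance $\delta^2$. Then for any Borel set $A\subset\mathbb R$ and $t\in[0,T]$ the cumulative probability distribution function of $X_t$ under $\mathbb Q$ possesses the representation $$\mathbb Q(X_t\in A)=\int_A e^{-\lambda t}\sum_{m=0}^\infty\frac{(\lambda t)^m}{m!\sqrt{2\pi(\sigma^2t+m\delta^2)}}\exp\Big\{-\frac12\,\frac{(x-\gamma t-m\mu)^2}{\sigma^2t+m\delta^2}\Big\}\,dx .$$
   Context: On a probability space with measure $\mathbb Q$ and for $t\in[0,T]$, $0<T<\infty$: $W$ is a standard Brownian motion, $N_t$ is a standard Poisson process with deterministic jump intensity $\lambda>0$ (so $N_t\sim\mathrm{Poi}(\lambda t)$), and $Y_1,Y_2,\dots$ are i.i.d. random variables modeling the jump amplitudes; $W$, $(N_t)$ and $Y_1,Y_2,\dots$ are altogether independent under $\mathbb Q$. Constants: $\sigma>0$ and $\gamma=\eta-\sigma^2/2$ with $\eta\in\mathbb R$.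
   Formalization: The formal statement takes 0 < t ≤ T instead of t ∈ [0,T]: at t = 0 the m = 0 term of the formula divides by zero, and X_0 = 0 almost surely has no density. *)

theory Defs
  imports "HOL-Probability.Probability"
begin

(* The second parameter is the variance; variance 0 gives the point mass at the mean. *)
definition normal_law :: "real \<Rightarrow> real \<Rightarrow> real measure" where
  "normal_law m v =
     (if v = 0 then return borel m
      else density lborel (\<lambda>x. ennreal (normal_density m (sqrt v) x)))"

definition has_independent_increments ::
  "'a measure \<Rightarrow> real \<Rightarrow> (real \<Rightarrow> 'a \<Rightarrow> real) \<Rightarrow> bool" where
  "has_independent_increments Q T Z \<longleftrightarrow>
     (\<forall>(n::nat) s. (\<forall>i\<le>n. s i \<in> {0..T}) \<and> (\<forall>i<n. s i < s (Suc i)) \<longrightarrow>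
        prob_space.indep_vars Q (\<lambda>_. borel) (\<lambda>i \<omega>. Z (s (Suc i)) \<omega> - Z (s i) \<omega>) {..<n})"

definition standard_brownian_motion ::
  "'a measure \<Rightarrow> real \<Rightarrow> (real \<Rightarrow> 'a \<Rightarrow> real) \<Rightarrow> bool" where
  "standard_brownian_motion Q T W \<longleftrightarrow>
     (\<forall>t\<in>{0..T}. W t \<in> borel_measurable Q) \<and>
     (AE \<omega> in Q. W 0 \<omega> = 0) \<and>
     has_independent_increments Q T W \<and>
     (\<forall>s t. 0 \<le> s \<and> s < t \<and> t \<le> T \<longrightarrow>
        distr Q borel (\<lambda>\<omega>. W t \<omega> - W s \<omega>) = normal_law 0 (t - s)) \<and>
     (AE \<omega> in Q. continuous_on {0..T} (\<lambda>t. W t \<omega>))"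

(* Almost every path is nondecreasing, so the truncated difference N t - N s
   in the law of the increments agrees almost surely with the true difference. *)
definition poisson_process ::
  "'a measure \<Rightarrow> real \<Rightarrow> real \<Rightarrow> (real \<Rightarrow> 'a \<Rightarrow> nat) \<Rightarrow> bool" where
  "poisson_process Q T rate N \<longleftrightarrow>
     (\<forall>t\<in>{0..T}. N t \<in> measurable Q (count_space UNIV)) \<and>
     (AE \<omega> in Q. N 0 \<omega> = 0) \<and>
     has_independent_increments Q T (\<lambda>t \<omega>. real (N t \<omega>)) \<and>
     (\<forall>s t. 0 \<le> s \<and> s < t \<and> t \<le> T \<longrightarrow>
        distr Q (count_space UNIV) (\<lambda>\<omega>. N t \<omega> - N s \<omega>)
          = measure_pmf (poisson_pmf (rate * (t - s)))) \<and>
     (AE \<omega> in Q. mono_on {0..T} (\<lambda>t. N t \<omega>) \<and>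
        (\<forall>t\<in>{0..<T}. continuous (at_right t) (\<lambda>s. real (N s \<omega>))))"

definition generated_events ::
  "'a measure \<Rightarrow> 'b measure \<Rightarrow> 'i set \<Rightarrow> ('i \<Rightarrow> 'a \<Rightarrow> 'b) \<Rightarrow> 'a set set" where
  "generated_events Q S I Z =
     sigma_sets (space Q) (\<Union>i\<in>I. {Z i -` A \<inter> space Q | A. A \<in> sets S})"

datatype noise = Brownian | Counting | Jump nat

(* Joint independence of the whole process W, the whole process N and the single variables
   Y 1, Y 2, ...; in particular the Y j are mutually independent. Y 0 is not used. *)
definition jointly_independent ::
  "'a measure \<Rightarrow> real \<Rightarrow> (real \<Rightarrow> 'a \<Rightarrow> real) \<Rightarrow> (real \<Rightarrow> 'a \<Rightarrow> nat) \<Rightarrow> (nat \<Rightarrow> 'a \<Rightarrow> real) \<Rightarrow> bool" where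
  "jointly_independent Q T W N Y \<longleftrightarrow>
     prob_space.indep_sets Q
       (\<lambda>c. case c of
           Brownian \<Rightarrow> generated_events Q borel {0..T} W
         | Counting \<Rightarrow> generated_events Q (count_space UNIV) {0..T} N
         | Jump j \<Rightarrow> generated_events Q borel {j} Y)
       ({Brownian, Counting} \<union> Jump ` {1..})"

end

theory Submission
  imports Defs
begin

text \<open>Conditioning on the number of jumps, \<open>X t\<close> becomes a sum of independent normal variables,
  with mean \<open>\<gamma> t + m \<mu>\<close> and variance \<open>\<sigma>\<^sup>2 t + m \<delta>\<^sup>2\<close> on the event \<open>N t = m\<close>. Weighting these laws
  with the Poisson probabilities and exchanging sum and integral by monotone convergence gives
  the density. The jumps have no density when \<open>\<delta> = 0\<close>; adding them one at a time to the Brownian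
  part, which has one, covers this case as well.\<close>

section \<open>Sums of independent, possibly degenerate, normal variables\<close>

lemma (in prob_space) distributed_normal_law:
  assumes "v > 0" "random_variable borel X" "distr M borel X = normal_law m v"
  shows "distributed M lborel X (normal_density m (sqrt v))"
proof -
  have "distr M lborel X = distr M borel X"
    by (rule distr_cong) auto
  with assms show ?thesis
    by (auto simp: distributed_def normal_law_def)
qed

text \<open>For \<open>v > 0\<close> two normal densities are convolved. For \<open>v = 0\<close>
  the variable \<open>Y\<close> is almost surely the constant \<open>b\<close>, so the sum is a
  translate of \<open>X\<close> and inherits its density.\<close>

lemma (in prob_space) distributed_add_normal_law:
  assumes indep: "indep_var borel Y borel X" and "0 < s" "0 \<le> v"
    and X: "distributed M lborel X (normal_density a s)"
    and Y: "distr M borel Y = normal_law b v"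
  shows "distributed M lborel (\<lambda>\<omega>. Y \<omega> + X \<omega>) (normal_density (b + a) (sqrt (v + s\<^sup>2)))"
proof (cases "v = 0")
  case True
  have [measurable]: "random_variable borel Y" "random_variable borel X"
    using indep_var_rv1[OF indep] indep_var_rv2[OF indep] by auto
  have "AE y in distr M borel Y. y = b"
    unfolding Y normal_law_def using True by (simp add: AE_return del: AE_distr_iff)
  then have *: "AE \<omega> in M. Y \<omega> = b"
    by (simp add: AE_distr_iff)
  \<comment> \<open>The factor 1 casts the translation into the affine form of
    \<open>normal_density_affine\<close>.\<close>
  have "distributed M lborel (\<lambda>\<omega>. b + 1 * X \<omega>) (normal_density (b + 1 * a) (\<bar>1\<bar> * s))"
    by (rule normal_density_affine) (use X \<open>0 < s\<close> in auto)
  moreover have "distr M lborel (\<lambda>\<omega>. Y \<omega> + X \<omega>) = distr M lborel (\<lambda>\<omega>. b + X \<omega>)"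
    by (rule distr_cong_AE) (use * in auto)
  ultimately show ?thesis
    using True \<open>0 < s\<close> by (simp add: distributed_def)
next
  case False
  then have "0 < v"
    using \<open>0 \<le> v\<close> by simp
  then have "distributed M lborel Y (normal_density b (sqrt v))"
    using distributed_normal_law[OF _ indep_var_rv1[OF indep] Y] by blast
  from add_indep_normal[OF indep _ \<open>0 < s\<close> this X] \<open>0 < v\<close> show ?thesis
    by simp
qed

text \<open>Induction on \<open>J\<close>, with \<open>V i\<close> kept in every partial sum: it
  supplies a density from the start, so each step adds one possibly degenerate summand to a sum that
  already has a density.\<close>

lemma (in prob_space) distributed_sum_normal_law:
  fixes V :: "'i \<Rightarrow> 'a \<Rightarrow> real"
  assumes "finite J" "i \<notin> J" "indep_vars (\<lambda>_. borel) V (insert i J)" "0 < s" "0 \<le> v"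
    and "distributed M lborel (V i) (normal_density a s)"
    and "\<And>j. j \<in> J \<Longrightarrow> distr M borel (V j) = normal_law b v"
  shows "distributed M lborel (\<lambda>\<omega>. \<Sum>j\<in>insert i J. V j \<omega>)
           (normal_density (a + real (card J) * b) (sqrt (s\<^sup>2 + real (card J) * v)))"
  using assms
proof (induction J)
  case empty
  then show ?case by simp
next
  case (insert j J)
  let ?n = "real (card J)"
  have "indep_vars (\<lambda>_. borel) V (insert i J)"
    by (rule indep_vars_subset[OF insert.prems(2)]) auto
  with insert have IH: "distributed M lborel (\<lambda>\<omega>. \<Sum>j\<in>insert i J. V j \<omega>)
           (normal_density (a + ?n * b) (sqrt (s\<^sup>2 + ?n * v)))"
    by simp
  have j: "j \<notin> insert i J" "insert j (insert i J) = insert i (insert j J)"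
    using insert by auto
  have indep: "indep_var borel (V j) borel (\<lambda>\<omega>. \<Sum>j\<in>insert i J. V j \<omega>)"
    using insert.hyps insert.prems(2) j by (intro indep_vars_sum) auto
  \<comment> \<open>\<open>normal_density\<close> takes a standard deviation; this positivity makes
    the root of the partial variance admissible and lets squaring undo the root.\<close>
  have pos: "0 < s\<^sup>2 + ?n * v"
    using insert.prems by (simp add: add_pos_nonneg)
  have "distributed M lborel (\<lambda>\<omega>. V j \<omega> + (\<Sum>j\<in>insert i J. V j \<omega>))
          (normal_density (b + (a + ?n * b)) (sqrt (v + (sqrt (s\<^sup>2 + ?n * v))\<^sup>2)))"
    by (rule distributed_add_normal_law[OF indep]) (use insert.prems pos IH in auto)
  moreover have "(\<lambda>\<omega>. V j \<omega> + (\<Sum>j\<in>insert i J. V j \<omega>)) = (\<lambda>\<omega>. \<Sum>j\<in>insert i (insert j J). V j \<omega>)"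
    unfolding j(2)[symmetric] using insert.hyps(1) j(1) by (subst sum.insert[of "insert i J" j]) auto
  moreover have "b + (a + ?n * b) = a + real (card (insert j J)) * b"
    "v + (sqrt (s\<^sup>2 + ?n * v))\<^sup>2 = s\<^sup>2 + real (card (insert j J)) * v"
    using insert.hyps pos by (auto simp: algebra_simps)
  ultimately show ?case
    by simp
qed

section \<open>Independence of the noise sources at a fixed time\<close>

lemma vimage_generated_events:
  assumes "i \<in> I" "A \<in> sets S"
  shows "Z i -` A \<inter> space Q \<in> generated_events Q S I Z"
  unfolding generated_events_def using assms by (intro sigma_sets.Basic) auto

text \<open>The events of a process at the single time \<open>t\<close> lie among those generated by
  its whole path, and independence passes to smaller families of events. The count is made real so
  that all components share the target \<open>borel\<close>.\<close>

lemma indep_vars_jointly_independent: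
  assumes "prob_space Q" and "jointly_independent Q T W N Y" and "t \<in> {0..T}"
    and [measurable]: "W t \<in> borel_measurable Q" "N t \<in> measurable Q (count_space UNIV)"
    and "\<And>j. 1 \<le> j \<Longrightarrow> Y j \<in> borel_measurable Q"
  shows "prob_space.indep_vars Q (\<lambda>_. borel)
           (\<lambda>c \<omega>. case c of Brownian \<Rightarrow> W t \<omega> | Counting \<Rightarrow> real (N t \<omega>) | Jump j \<Rightarrow> Y j \<omega>)
           ({Brownian, Counting} \<union> Jump ` {1..})"
proof -
  interpret prob_space Q by fact
  let ?V = "\<lambda>c \<omega>. case c of Brownian \<Rightarrow> W t \<omega> | Counting \<Rightarrow> real (N t \<omega>) | Jump j \<Rightarrow> Y j \<omega>"
  have "{?V c -` A \<inter> space Q |A. A \<in> sets borel} \<subseteq>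
          (case c of
             Brownian \<Rightarrow> generated_events Q borel {0..T} W
           | Counting \<Rightarrow> generated_events Q (count_space UNIV) {0..T} N
           | Jump j \<Rightarrow> generated_events Q borel {j} Y)" for c
  proof (cases c)
    case Counting
    have "(\<lambda>\<omega>. real (N t \<omega>)) -` A \<inter> space Q = N t -` (real -` A) \<inter> space Q" for A
      by auto
    with Counting \<open>t \<in> {0..T}\<close> show ?thesis
      by (auto intro!: vimage_generated_events)
  qed (use \<open>t \<in> {0..T}\<close> in \<open>auto intro!: vimage_generated_events\<close>)
  moreover have "random_variable borel (?V c)" if "c \<in> {Brownian, Counting} \<union> Jump ` {1..}" for c
    using that assms(6) by auto
  ultimately show ?thesis
    unfolding indep_vars_def2
    using assms(2) unfolding jointly_independent_def
    by (auto intro: indep_sets_mono_sets)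
qed

section \<open>Laws of the processes at a fixed time\<close>

lemma standard_brownian_motion_distr:
  assumes "standard_brownian_motion Q T W" "t \<in> {0<..T}"
  shows "distr Q borel (W t) = normal_law 0 t"
proof -
  have [measurable]: "W t \<in> borel_measurable Q" "W 0 \<in> borel_measurable Q"
    and "AE \<omega> in Q. W 0 \<omega> = 0"
    using assms by (auto simp: standard_brownian_motion_def)
  then have "distr Q borel (W t) = distr Q borel (\<lambda>\<omega>. W t \<omega> - W 0 \<omega>)"
    by (intro distr_cong_AE) auto
  also have "\<dots> = normal_law 0 (t - 0)"
    using assms unfolding standard_brownian_motion_def by auto
  finally show ?thesis by simp
qed

lemma poisson_process_distr:
  assumes "poisson_process Q T rate N" "t \<in> {0<..T}"
  shows "distr Q (count_space UNIV) (N t) = measure_pmf (poisson_pmf (rate * t))"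
proof -
  have [measurable]: "N t \<in> measurable Q (count_space UNIV)" "N 0 \<in> measurable Q (count_space UNIV)"
    and "AE \<omega> in Q. N 0 \<omega> = 0"
    using assms by (auto simp: poisson_process_def)
  \<comment> \<open>Since \<open>N 0\<close> vanishes almost surely, the truncated subtraction is
    harmless here.\<close>
  then have "distr Q (count_space UNIV) (N t) = distr Q (count_space UNIV) (\<lambda>\<omega>. N t \<omega> - N 0 \<omega>)"
    by (intro distr_cong_AE) auto
  also have "\<dots> = measure_pmf (poisson_pmf (rate * (t - 0)))"
    using assms unfolding poisson_process_def by auto
  finally show ?thesis by simp
qed

lemma poisson_process_prob_eq:
  assumes "poisson_process Q T rate N" "t \<in> {0<..T}" "0 < rate"
  shows "measure Q {\<omega> \<in> space Q. N t \<omega> = m} = (rate * t) ^ m / fact m * exp (- (rate * t))"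
proof -
  have N: "N t \<in> measurable Q (count_space UNIV)"
    using assms by (auto simp: poisson_process_def)
  have "measure Q {\<omega> \<in> space Q. N t \<omega> = m} = measure (distr Q (count_space UNIV) (N t)) {m}"
    by (subst measure_distr[OF N]) (auto intro!: arg_cong[where f="measure Q"])
  also have "\<dots> = pmf (poisson_pmf (rate * t)) m"
    by (simp add: poisson_process_distr[OF assms(1,2)] measure_pmf_single)
  finally show ?thesis
    using assms by simp
qed

section \<open>A uniform bound and the exchange of sum and integral\<close>

lemma normal_density_le:
  assumes "0 < c" "c \<le> v"
  shows "normal_density a (sqrt v) x \<le> 1 / sqrt (2 * pi * c)"
proof -
  \<comment> \<open>The exponential is at most 1 and the normalising factor decreases in the
    variance, so the bound is free of \<open>a\<close> and \<open>x\<close>.\<close>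
  have "1 / sqrt (2 * pi * v) * exp (- (x - a)\<^sup>2 / (2 * v)) \<le> 1 / sqrt (2 * pi * c) * 1"
    using assms by (intro mult_mono divide_left_mono) auto
  then show ?thesis
    using assms by (simp add: normal_density_def)
qed

text \<open>Monotone convergence for nonnegative terms; pointwise summability identifies the real
  series with the extended one. If the integral is infinite, both sides take the default value
  0.\<close>

lemma set_lebesgue_integral_eq_nn_integral_suminf:
  fixes f :: "nat \<Rightarrow> 'a \<Rightarrow> real"
  assumes [measurable]: "\<And>m. f m \<in> borel_measurable M" "A \<in> sets M"
    and nonneg: "\<And>m x. 0 \<le> f m x" and summable: "\<And>x. summable (\<lambda>m. f m x)"
  shows "(LINT x:A|M. (\<Sum>m. f m x)) = enn2real (\<Sum>m. \<integral>\<^sup>+x. ennreal (f m x) * indicator A x \<partial>M)"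
proof -
  have "ennreal (indicator A x *\<^sub>R (\<Sum>m. f m x)) = (\<Sum>m. ennreal (f m x) * indicator A x)" for x
    using suminf_ennreal2[OF nonneg summable] by (simp split: split_indicator)
  then have "(\<integral>\<^sup>+x. ennreal (indicator A x *\<^sub>R (\<Sum>m. f m x)) \<partial>M)
      = (\<integral>\<^sup>+x. (\<Sum>m. ennreal (f m x) * indicator A x) \<partial>M)"
    by presburger
  also have "\<dots> = (\<Sum>m. \<integral>\<^sup>+x. ennreal (f m x) * indicator A x \<partial>M)"
    by (rule nn_integral_suminf) simp
  finally have "(\<integral>\<^sup>+x. ennreal (indicator A x *\<^sub>R (\<Sum>m. f m x)) \<partial>M)
      = (\<Sum>m. \<integral>\<^sup>+x. ennreal (f m x) * indicator A x \<partial>M)" .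
  then show ?thesis
    unfolding set_lebesgue_integral_def
    by (subst integral_eq_nn_integral) (auto intro!: mult_nonneg_nonneg suminf_nonneg nonneg summable)
qed

section \<open>The law of \<open>X t\<close> as a Poisson mixture of normal laws\<close>

theorem proposition2p5:
  fixes Q :: "'a measure"
    and W X :: "real \<Rightarrow> 'a \<Rightarrow> real"
    and N :: "real \<Rightarrow> 'a \<Rightarrow> nat"
    and Y :: "nat \<Rightarrow> 'a \<Rightarrow> real"
    and T rate \<sigma> \<eta> \<gamma> \<mu> \<delta> t :: real
    and A :: "real set"
  assumes "prob_space Q"
    and "0 < T" and "0 < rate" and "0 < \<sigma>"
    and "\<gamma> = \<eta> - \<sigma>\<^sup>2 / 2"
    and "standard_brownian_motion Q T W"
    and "poisson_process Q T rate N"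
    and "\<And>j. 1 \<le> j \<Longrightarrow> Y j \<in> borel_measurable Q"
    and "\<And>j. 1 \<le> j \<Longrightarrow> distr Q borel (Y j) = normal_law \<mu> (\<delta>\<^sup>2)"
    and "jointly_independent Q T W N Y"
    and "\<And>s \<omega>. s \<in> {0..T} \<Longrightarrow> \<omega> \<in> space Q \<Longrightarrow>
           X s \<omega> = \<gamma> * s + \<sigma> * W s \<omega> + (\<Sum>j = 1..N s \<omega>. Y j \<omega>)"
    and "t \<in> {0<..T}"
    and "A \<in> sets borel"
  shows "measure Q {\<omega> \<in> space Q. X t \<omega> \<in> A} =
    (LINT x:A|lborel. exp (- (rate * t)) *
       (\<Sum>m. (rate * t) ^ m / (fact m * sqrt (2 * pi * (\<sigma>\<^sup>2 * t + real m * \<delta>\<^sup>2)))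
            * exp (- (1 / 2) * ((x - \<gamma> * t - real m * \<mu>)\<^sup>2 / (\<sigma>\<^sup>2 * t + real m * \<delta>\<^sup>2)))))"
proof -
  interpret prob_space Q by fact
  let ?p = "\<lambda>m. (rate * t) ^ m / fact m * exp (- (rate * t))"
  let ?v = "\<lambda>m. \<sigma>\<^sup>2 * t + real m * \<delta>\<^sup>2"
  let ?g = "\<lambda>m x. normal_density (\<gamma> * t + real m * \<mu>) (sqrt (?v m)) x"
  have t: "0 < t" "t \<in> {0..T}"
    using assms(12) by auto
  have [measurable]: "W t \<in> borel_measurable Q" "N t \<in> measurable Q (count_space UNIV)"
    using assms(6,7) t by (auto simp: standard_brownian_motion_def poisson_process_def)
  have [measurable]: "A \<in> sets borel"
    by fact
  \<comment> \<open>The Brownian part bounds all variances from below by one positive constant,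
    which later makes the majorant of the series independent of \<open>m\<close> in its second
    factor.\<close>
  have v: "0 < \<sigma>\<^sup>2 * t" "\<sigma>\<^sup>2 * t \<le> ?v m" for m
    using \<open>0 < \<sigma>\<close> t by auto

  \<comment> \<open>Drift and volatility are absorbed into the Brownian component, so that
    \<open>X t\<close> given \<open>m\<close> jumps is a plain sum over one independent
    family.\<close>
  define V where "V c \<omega> = (case c of Brownian \<Rightarrow> \<gamma> * t + \<sigma> * W t \<omega>
    | Counting \<Rightarrow> real (N t \<omega>) | Jump j \<Rightarrow> Y j \<omega>)" for c \<omega>
  have "indep_vars (\<lambda>_. borel)
      (\<lambda>c \<omega>. (case c of Brownian \<Rightarrow> (\<lambda>x. \<gamma> * t + \<sigma> * x) | _ \<Rightarrow> (\<lambda>x. x))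
         (case c of Brownian \<Rightarrow> W t \<omega> | Counting \<Rightarrow> real (N t \<omega>) | Jump j \<Rightarrow> Y j \<omega>))
      ({Brownian, Counting} \<union> Jump ` {1..})"
    by (rule indep_vars_compose2[OF indep_vars_jointly_independent[OF assms(1,10) t(2)]])
       (use assms(8) in \<open>auto split: noise.split\<close>)
  also have "(\<lambda>c \<omega>. (case c of Brownian \<Rightarrow> (\<lambda>x. \<gamma> * t + \<sigma> * x) | _ \<Rightarrow> (\<lambda>x. x))
         (case c of Brownian \<Rightarrow> W t \<omega> | Counting \<Rightarrow> real (N t \<omega>) | Jump j \<Rightarrow> Y j \<omega>)) = V"
    by (auto simp: fun_eq_iff V_def split: noise.split)
  finally have indep: "indep_vars (\<lambda>_. borel) V ({Brownian, Counting} \<union> Jump ` {1..})" .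

  \<comment> \<open>\<open>S m\<close> is \<open>X t\<close> with the random count frozen at
    \<open>m\<close>. The index \<open>Counting\<close> is left out, so \<open>S m\<close> is
    independent of \<open>N t\<close>.\<close>
  define S where "S m \<omega> = (\<Sum>c\<in>insert Brownian (Jump ` {1..m}). V c \<omega>)" for m \<omega>
  have S_eq: "S m \<omega> = \<gamma> * t + \<sigma> * W t \<omega> + (\<Sum>j = 1..m. Y j \<omega>)" for m \<omega>
  proof -
    have "(\<Sum>c\<in>Jump ` {1..m}. V c \<omega>) = (\<Sum>j = 1..m. Y j \<omega>)"
      by (subst sum.reindex) (auto simp: inj_on_def V_def)
    then show ?thesis
      unfolding S_def by (subst sum.insert) (auto simp: V_def)
  qed
  have S_distr: "distributed Q lborel (S m) (?g m)" for m
  proof -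
    have "distributed Q lborel (W t) (normal_density 0 (sqrt t))"
      by (rule distributed_normal_law) (use t standard_brownian_motion_distr[OF assms(6,12)] in auto)
    then have "distributed Q lborel (\<lambda>\<omega>. \<gamma> * t + \<sigma> * W t \<omega>)
        (normal_density (\<gamma> * t + \<sigma> * 0) (\<bar>\<sigma>\<bar> * sqrt t))"
      by (rule normal_density_affine) (use t \<open>0 < \<sigma>\<close> in auto)
    then have B: "distributed Q lborel (V Brownian) (normal_density (\<gamma> * t) (\<sigma> * sqrt t))"
      using \<open>0 < \<sigma>\<close> by (simp add: V_def[abs_def])
    have card: "card (Jump ` {1..m}) = m"
      by (subst card_image) (auto simp: inj_on_def)
    \<comment> \<open>The Brownian component is the summand with a density, so \<delta> = 0 is
      covered too.\<close>
    have "distributed Q lborel (\<lambda>\<omega>. \<Sum>c\<in>insert Brownian (Jump ` {1..m}). V c \<omega>)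
        (normal_density (\<gamma> * t + real (card (Jump ` {1..m})) * \<mu>)
          (sqrt ((\<sigma> * sqrt t)\<^sup>2 + real (card (Jump ` {1..m})) * \<delta>\<^sup>2)))"
    proof (rule distributed_sum_normal_law)
      show "indep_vars (\<lambda>_. borel) V (insert Brownian (Jump ` {1..m}))"
        by (rule indep_vars_subset[OF indep]) auto
      show "distr Q borel (V c) = normal_law \<mu> (\<delta>\<^sup>2)" if "c \<in> Jump ` {1..m}" for c
        using that assms(9) by (auto simp: V_def[abs_def])
    qed (use B t \<open>0 < \<sigma>\<close> in auto)
    then show ?thesis
      unfolding card using t by (simp add: S_def[abs_def] power_mult_distrib)
  qed
  have [measurable]: "random_variable borel (S m)" for m
    using distributed_measurable[OF S_distr] by simp

  \<comment> \<open>The event \<open>X t \<in> A\<close> is split by the number of jumps; where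
    \<open>N t = m\<close>, \<open>X t\<close> equals \<open>S m\<close>.\<close>
  define E where "E m = {\<omega> \<in> space Q. N t \<omega> = m \<and> S m \<omega> \<in> A}" for m
  have [measurable]: "E m \<in> sets Q" for m
    unfolding E_def by measurable
  have prob_E: "emeasure Q (E m) = (\<integral>\<^sup>+x. ennreal (?p m * ?g m x) * indicator A x \<partial>lborel)" for m
  proof -
    have "indep_var borel (V Counting) borel (S m)"
      unfolding S_def[abs_def] by (intro indep_vars_sum indep_vars_subset[OF indep]) auto
    then have "\<P>(\<omega> in Q. V Counting \<omega> \<in> {real m} \<and> S m \<omega> \<in> A)
        = \<P>(\<omega> in Q. V Counting \<omega> \<in> {real m}) * \<P>(\<omega> in Q. S m \<omega> \<in> A)"
      by (rule prob_indep_random_variable) auto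
    then have "prob (E m) = ?p m * \<P>(\<omega> in Q. S m \<omega> \<in> A)"
      using poisson_process_prob_eq[OF assms(7,12,3)] by (simp add: V_def E_def)
    moreover have "emeasure Q {\<omega> \<in> space Q. S m \<omega> \<in> A} = (\<integral>\<^sup>+x. ennreal (?g m x) * indicator A x \<partial>lborel)"
      using distributed_emeasure[OF S_distr, of A m] by (simp add: vimage_def Int_def conj_commute)
    ultimately have "emeasure Q (E m) = ?p m * (\<integral>\<^sup>+x. ennreal (?g m x) * indicator A x \<partial>lborel)"
      using assms(3) t by (simp add: emeasure_eq_measure ennreal_mult del: times_divide_eq_left times_divide_eq_right)
    also have "\<dots> = (\<integral>\<^sup>+x. ennreal (?p m) * (ennreal (?g m x) * indicator A x) \<partial>lborel)"
      by (rule nn_integral_cmult[symmetric]) simp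
    also have "\<dots> = (\<integral>\<^sup>+x. ennreal (?p m * ?g m x) * indicator A x \<partial>lborel)"
      using assms(3) t by (intro nn_integral_cong) (simp add: ennreal_mult mult.assoc del: times_divide_eq_left times_divide_eq_right)
    finally show ?thesis .
  qed

  have "{\<omega> \<in> space Q. X t \<omega> \<in> A} = (\<Union>m. E m)"
    using assms(11)[OF t(2)] by (auto simp: E_def S_eq)
  moreover have "disjoint_family E"
    by (auto simp: disjoint_family_on_def E_def)
  ultimately have "emeasure Q {\<omega> \<in> space Q. X t \<omega> \<in> A} = (\<Sum>m. emeasure Q (E m))"
    by (simp add: suminf_emeasure image_subset_iff)
  then have lhs: "measure Q {\<omega> \<in> space Q. X t \<omega> \<in> A}
      = enn2real (\<Sum>m. \<integral>\<^sup>+x. ennreal (?p m * ?g m x) * indicator A x \<partial>lborel)"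
    by (simp add: measure_def prob_E)

  \<comment> \<open>Majorant: the Poisson weights, summable by the exponential series, times the
    bound of \<open>normal_density_le\<close> with \<open>c = \<sigma>\<^sup>2 * t\<close>.\<close>
  have summable: "summable (\<lambda>m. ?p m * ?g m x)" for x
  proof (rule summable_comparison_test')
    have "summable (\<lambda>m. (rate * t) ^ m / fact m)"
      using summable_exp[of "rate * t"] by (simp add: field_simps)
    then show "summable (\<lambda>m. ?p m * (1 / sqrt (2 * pi * (\<sigma>\<^sup>2 * t))))"
      by (intro summable_mult2)
    show "norm (?p m * ?g m x) \<le> ?p m * (1 / sqrt (2 * pi * (\<sigma>\<^sup>2 * t)))" if "0 \<le> m" for m
      using normal_density_le[OF v(1) v(2)[of m], of "\<gamma> * t + real m * \<mu>" x] assms(3) t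
      by (simp add: abs_mult mult_left_mono del: times_divide_eq_right times_divide_eq_left)
  qed
  have eq: "exp (- (rate * t)) * ((rate * t) ^ m / (fact m * sqrt (2 * pi * ?v m))
            * exp (- (1 / 2) * ((x - \<gamma> * t - real m * \<mu>)\<^sup>2 / ?v m))) = ?p m * ?g m x" for m x
    using v(1) v(2)[of m] by (simp add: normal_density_def diff_diff_eq field_simps)
  \<comment> \<open>Pulling the exponential into the series requires summability without that
    factor; this follows from \<open>summable\<close> because the factor is nonzero.\<close>
  have "exp (- (rate * t)) *
       (\<Sum>m. (rate * t) ^ m / (fact m * sqrt (2 * pi * ?v m))
            * exp (- (1 / 2) * ((x - \<gamma> * t - real m * \<mu>)\<^sup>2 / ?v m))) = (\<Sum>m. ?p m * ?g m x)" for x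
    unfolding eq[symmetric]
    by (rule suminf_mult[symmetric])
       (use summable[of x] in \<open>simp only: eq[symmetric] summable_cmult_iff, simp\<close>)
  then show ?thesis
    unfolding lhs using assms(3) t
    by (simp only:) (intro set_lebesgue_integral_eq_nn_integral_suminf[symmetric] summable; simp)
qed

end
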